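(* Suppose $\mu$ and $\lambda$ are Borel measures on $S^{n-1}$, where $\mu=\sum_{i=1}^m\mu_i\delta_{v_i}$ is discrete and not concentrated on a closed hemisphere, and $\lambda$ is absolutely continuous. If $\mu$ is weakly Aleksandrov related to $\lambda$, then there exists a polytope $P\in\mathcal P_\mu$ such that $\mu=\lambda(P,\cdot)$.
   Context: $S^{n-1}$ is the unit sphere of $\mathbb R^n$; absolutely continuous means with respect to spherical Lebesgue measure. A measure $\mu$ on $S^{n-1}$ is discrete if $\mu=\sum_{i=1}^m\mu_i\delta_{v_i}$ with finitely many (distinct) $v_i\in S^{n-1}$ and coefficients $\mu_i>0$, where $\delta_{v_i}$ is the Dirac measure at $v_i$. For such $\mu$, $\mathcal P_\mu=\{\operatorname{conv}\{\beta_iv_i\mid 1\le i\le m\}\mid(\beta_1,\dots,\beta_m)\in\mathbb R^m_{>0}\}$. If $\mu$ is not concentrated on a closed hemisphere (i.e. no closed hemisphere contains all $v_i$), every member of $\mathcal P_\mu$ is a convex body containing the origin in its interior. For a closed set $\omega\subset S^{n-1}$ and $\beta\in(0,\frac\pi2]$, the outer parallel set is $\omega_\beta=\bigcup_{u\in\omega}\{v\in S^{n-1}:u\cdot v>\cos\beta\}$. Weak Aleksandrov relation: $\mu$ is weakly Aleksandrov related to $\lambda$ if $\mu(S^{n-1})=\lambda(S^{n-1})$ and for each closed set $\omega\subset S^{n-1}$ contained in a closed hemisphere there exists $\alpha\in(0,\frac\pi2)$ such that $\mu(\omega)\le\lambda(\omega_{\frac\pi2-\alpha})$. For a convex body $K$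 (compact convex, nonempty interior) containing the origin in its interior: $\rho_K(u)=\max\{a:au\in K\}$ and $r_K(u)=\rho_K(u)u\in\partial K$ for $u\in S^{n-1}$; for $x\in\partial K$ the normal cone is $N(K,x)=\{v\in S^{n-1}:(y-x)\cdot v\le0\text{ for all }y\in K\}$; the radial Gauss image of $\omega\subset S^{n-1}$ is $\boldsymbol\alpha_K(\omega)=\bigcup_{u\in\omega}N(K,r_K(u))$. It maps Borel sets to Lebesgue measurable sets, and $\lambda(K,\omega):=\lambda(\boldsymbol\alpha_K(\omega))$ for Borel $\omega\subset S^{n-1}$ (an absolutely continuous $\lambda$ is regarded as defined on Lebesgue measurable sets). *)

theory Defs
  imports "HOL-Probability.Probability"
begin

text \<open>Throughout, \<open>n = CARD('n)\<close> and the unit sphere is \<^term>\<open>sphere 0 1 :: (real ^ 'n) set\<close>.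
  A Borel measure on the sphere is a measure whose measurable sets are those of the
  following space.\<close>

abbreviation borel_sphere :: "(real ^ 'n) measure" where
  "borel_sphere \<equiv> restrict_space borel (sphere 0 1)"

text \<open>The spherical Lebesgue measure is normalised so that it agrees with surface area:
  it sends \<open>A\<close> to \<open>n\<close> times the volume of the cone \<open>{t u | 0 < t \<le> 1, u \<in> A}\<close>.
  It is used only through its null sets.\<close>

definition spherical_lebesgue :: "(real ^ 'n) measure" where
  "spherical_lebesgue =
     scale_measure (of_nat CARD('n))
       (distr (restrict_space lborel (cball 0 1 - {0})) borel_sphere (\<lambda>x. x /\<^sub>R norm x))"

lemma emeasure_spherical_lebesgue:
  fixes A :: "(real ^ 'n) set"
  assumes "A \<in> sets borel_sphere"
  shows "emeasure spherical_lebesgue A =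
    of_nat CARD('n) * emeasure lborel {t *\<^sub>R u | t u. 0 < t \<and> t \<le> 1 \<and> u \<in> A}"
proof -
  let ?M = "restrict_space lborel (cball 0 1 - {0}) :: (real ^ 'n) measure"
  let ?f = "\<lambda>x :: real ^ 'n. x /\<^sub>R norm x"
  have meas: "?f \<in> measurable ?M borel_sphere"
  proof (rule measurable_restrict_space2)
    show "?f \<in> space ?M \<rightarrow> sphere 0 1"
      by (auto simp: space_restrict_space)
    show "?f \<in> borel_measurable ?M"
      by (rule measurable_restrict_space1) measurable
  qed
  have A: "A \<subseteq> sphere 0 1"
    using sets.sets_into_space[OF assms] by (simp add: space_restrict_space)
  have eq: "?f -` A \<inter> space ?M = {t *\<^sub>R u | t u. 0 < t \<and> t \<le> 1 \<and> u \<in> A}" (is "?L = ?R")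
  proof (intro subset_antisym subsetI)
    fix x assume x: "x \<in> ?L"
    then have "x = norm x *\<^sub>R ?f x" "0 < norm x" "norm x \<le> 1" "?f x \<in> A"
      by (auto simp: space_restrict_space)
    then show "x \<in> ?R" by blast
  next
    fix x assume "x \<in> ?R"
    then obtain t u where tu: "x = t *\<^sub>R u" "0 < t" "t \<le> 1" "u \<in> A" by blast
    with A have nu: "norm u = 1" by auto
    with tu have "?f x = u" "norm x \<le> 1" "x \<noteq> 0" by auto
    with tu show "x \<in> ?L" by (auto simp: space_restrict_space)
  qed
  have "emeasure ?M ?R = emeasure lborel ?R"
    by (rule emeasure_restrict_space) (use eq in \<open>auto simp: space_restrict_space\<close>)
  then show ?thesis
    unfolding spherical_lebesgue_def emeasure_scale_measure emeasure_distr[OF meas assms] eq by simp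
qed

definition discrete_on_sphere ::
  "(real ^ 'n) measure \<Rightarrow> nat \<Rightarrow> (nat \<Rightarrow> real) \<Rightarrow> (nat \<Rightarrow> real ^ 'n) \<Rightarrow> bool" where
  "discrete_on_sphere \<mu> m c v \<longleftrightarrow>
     sets \<mu> = sets borel_sphere \<and>
     inj_on v {1..m} \<and>
     (\<forall>i\<in>{1..m}. v i \<in> sphere 0 1 \<and> 0 < c i) \<and>
     (\<forall>A\<in>sets borel_sphere.
        emeasure \<mu> A = (\<Sum>i=1..m. ennreal (c i) * emeasure (return borel_sphere (v i)) A))"

definition polytopes_with_directions :: "nat \<Rightarrow> (nat \<Rightarrow> real ^ 'n) \<Rightarrow> (real ^ 'n) set set" where
  "polytopes_with_directions m v =
     {convex hull ((\<lambda>i. \<beta> i *\<^sub>R v i) ` {1..m}) | \<beta>. \<forall>i\<in>{1..m}. (0::real) < \<beta> i}"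

definition closed_hemisphere :: "(real ^ 'n) set \<Rightarrow> bool" where
  "closed_hemisphere H \<longleftrightarrow> (\<exists>u\<in>sphere 0 1. H = {v \<in> sphere 0 1. 0 \<le> u \<bullet> v})"

definition outer_parallel :: "(real ^ 'n) set \<Rightarrow> real \<Rightarrow> (real ^ 'n) set" where
  "outer_parallel \<omega> \<beta> = (\<Union>u\<in>\<omega>. {v \<in> sphere 0 1. cos \<beta> < u \<bullet> v})"

definition weakly_Aleksandrov_related ::
  "(real ^ 'n) measure \<Rightarrow> (real ^ 'n) measure \<Rightarrow> bool" where
  "weakly_Aleksandrov_related \<mu> \<nu> \<longleftrightarrow>
     emeasure \<mu> (sphere 0 1) = emeasure \<nu> (sphere 0 1) \<and>
     (\<forall>\<omega>. closed \<omega> \<and> \<omega> \<subseteq> sphere 0 1 \<and> (\<exists>H. closed_hemisphere H \<and> \<omega> \<subseteq> H) \<longrightarrow>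
        (\<exists>\<alpha>. 0 < \<alpha> \<and> \<alpha> < pi / 2 \<and> emeasure \<mu> \<omega> \<le> emeasure \<nu> (outer_parallel \<omega> (pi / 2 - \<alpha>))))"

definition radial_function :: "(real ^ 'n) set \<Rightarrow> real ^ 'n \<Rightarrow> real" where
  "radial_function K u = (GREATEST a. a *\<^sub>R u \<in> K)"

definition radial_map :: "(real ^ 'n) set \<Rightarrow> real ^ 'n \<Rightarrow> real ^ 'n" where
  "radial_map K u = radial_function K u *\<^sub>R u"

definition normal_cone :: "(real ^ 'n) set \<Rightarrow> real ^ 'n \<Rightarrow> (real ^ 'n) set" where
  "normal_cone K x = {v \<in> sphere 0 1. \<forall>y\<in>K. (y - x) \<bullet> v \<le> 0}"

definition radial_Gauss_image :: "(real ^ 'n) set \<Rightarrow> (real ^ 'n) set \<Rightarrow> (real ^ 'n) set" where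
  "radial_Gauss_image K \<omega> = (\<Union>u\<in>\<omega>. normal_cone K (radial_map K u))"

text \<open>The radial Gauss image of a Borel set is in general only Lebesgue measurable, so the
  Borel measure \<open>\<nu>\<close> has to be extended. If \<open>\<nu>\<close> is absolutely continuous, then every Lebesgue
  measurable subset of the sphere is measurable for the completion of \<open>\<nu>\<close>, which is the
  unique extension.\<close>

definition Gauss_image_measure ::
  "(real ^ 'n) measure \<Rightarrow> (real ^ 'n) set \<Rightarrow> (real ^ 'n) set \<Rightarrow> ennreal" where
  "Gauss_image_measure \<nu> K \<omega> = emeasure (completion \<nu>) (radial_Gauss_image K \<omega>)"

end

theory Submission
  imports Defs
begin

text \<open>For positive weights \<open>b\<close> let \<open>P\<close> be the convex hull of the points \<open>b i *\<^sub>R v i\<close>. A unit vector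
  \<open>u\<close> is normal to \<open>P\<close> at the vertex \<open>b i *\<^sub>R v i\<close> iff \<open>i\<close> maximises \<open>b j * (u \<bullet> v j)\<close> over all
  \<open>j\<close>; call the set of these \<open>u\<close> the cell of \<open>i\<close>. Cells overlap only along finitely many great
  subspheres, which are null for \<open>\<nu>\<close>. Hence the measure \<open>\<nu>(P, \<cdot>)\<close> is the sum of the point
  masses \<open>\<nu>(cell i)\<close> at \<open>v i\<close> (\<open>Gauss_image_measure_hull_of_scaled\<close>), and it remains to find
  weights for which the \<open>i\<close>-th cell has \<open>\<nu>\<close>-mass \<open>c i\<close> for every \<open>i\<close>
  (\<open>prescribed_cell_measures\<close>).

  The masses \<open>G b i = \<nu>(cell i)\<close> depend continuously on \<open>b\<close>, and \<open>G b i\<close> can only drop when the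
  other weights grow. These two properties alone yield, in any box \<open>[1, R]\<close>, weights with
  \<open>G b i \<le> c i\<close> wherever \<open>b i > 1\<close> and \<open>G b i \<ge> c i\<close> wherever \<open>b i < R\<close>: take the largest
  subsolution (\<open>box_complementarity\<close>).

  The weak Aleksandrov relation makes these inequalities equalities once \<open>R\<close> is large. Applied to
  \<open>{v i | i \<in> I}\<close>, or replaced by compactness of the sphere if this set lies in no closed
  hemisphere, it gives one \<open>d > 0\<close> such that, for all \<open>I\<close>, the total weight \<open>c(I)\<close> is at most the
  \<open>\<nu>\<close>-mass of the \<open>u\<close> with \<open>u \<bullet> v i > d\<close> for some \<open>i \<in> I\<close> (\<open>weakly_Aleksandrov_margin\<close>). If \<open>R\<close> is a sufficiently high power
  of \<open>1 / d\<close>, then by pigeonhole some ratio gap of size \<open>1 / d\<close> contains no weight. Let \<open>I\<close> be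
  the set of indices above the gap. Each \<open>u\<close> with \<open>u \<bullet> v i > d\<close> for some \<open>i \<in> I\<close> lies in a cell
  of \<open>I\<close>, as no weight below the gap can compete; so \<open>G(I) \<ge> c(I)\<close>. On \<open>I\<close> we also have
  \<open>G b i \<le> c i\<close>, hence equality there; off \<open>I\<close> we have \<open>G b i \<ge> c i\<close>, and since the total masses
  agree, equality holds there as well.\<close>

section \<open>A complementarity problem on a box\<close>

text \<open>The largest subsolution solves the problem. Subsolutions, that is, points with \<open>G t i \<le> c i\<close>
  wherever \<open>a < t i\<close>, are closed under pointwise maxima: at an index where the first argument is
  the larger one, passing to the maximum raises only other coordinates and thus does not raise
  \<open>G\<close>. By continuity the pointwise supremum is again a subsolution. If \<open>G t i < c i\<close> held there
  at some \<open>t i < b\<close>, then \<open>t i\<close> could be raised a little further, against maximality.\<close>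

lemma box_complementarity:
  fixes G :: "('i \<Rightarrow> real) \<Rightarrow> 'i \<Rightarrow> real" and c :: "'i \<Rightarrow> real" and a b :: real
  assumes A: "finite A" and ab: "a \<le> b"
    and cont: "\<And>s t i. \<lbrakk>\<And>k. s k \<in> A \<rightarrow> {a..b}; t \<in> A \<rightarrow> {a..b};
        \<And>j. j \<in> A \<Longrightarrow> (\<lambda>k::nat. s k j) \<longlonglongrightarrow> t j; i \<in> A\<rbrakk> \<Longrightarrow> (\<lambda>k. G (s k) i) \<longlonglongrightarrow> G t i"
    and antitone: "\<And>s t i. \<lbrakk>s \<in> A \<rightarrow> {a..b}; t \<in> A \<rightarrow> {a..b}; \<And>j. j \<in> A \<Longrightarrow> s j \<le> t j;
        i \<in> A; s i = t i\<rbrakk> \<Longrightarrow> G t i \<le> G s i"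
  obtains t where "t \<in> A \<rightarrow> {a..b}" "\<And>i. \<lbrakk>i \<in> A; a < t i\<rbrakk> \<Longrightarrow> G t i \<le> c i"
    "\<And>i. \<lbrakk>i \<in> A; t i < b\<rbrakk> \<Longrightarrow> c i \<le> G t i"
proof -
  define S where "S = {t \<in> A \<rightarrow> {a..b}. \<forall>i\<in>A. a < t i \<longrightarrow> G t i \<le> c i}"
  define t where "t i = Sup ((\<lambda>s. s i) ` S)" for i
  have bot: "(\<lambda>_. a) \<in> S" using ab by (auto simp: S_def)
  have box: "s \<in> A \<rightarrow> {a..b}" if "s \<in> S" for s using that by (simp add: S_def)
  have bdd: "bdd_above ((\<lambda>s. s i) ` S)" if "i \<in> A" for i
    using that box by (intro bdd_aboveI[of _ b]) fastforce
  have upper: "s i \<le> t i" if "s \<in> S" "i \<in> A" for s i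
    unfolding t_def using that bdd by (intro cSup_upper) auto
  have t_box: "t \<in> A \<rightarrow> {a..b}"
  proof
    fix i assume i: "i \<in> A"
    have "t i \<le> b" unfolding t_def
      using bot box i by (intro cSup_least) fastforce+
    then show "t i \<in> {a..b}" using upper[OF bot i] by simp
  qed
  have sup_mem: "(\<lambda>i. max (s i) (s' i)) \<in> S" if s: "s \<in> S" "s' \<in> S" for s s'
  proof -
    let ?w = "\<lambda>i. max (s i) (s' i)"
    have w: "?w \<in> A \<rightarrow> {a..b}" using box[OF s(1)] box[OF s(2)] by (auto simp: Pi_iff max_def)
    have "G ?w i \<le> c i" if i: "i \<in> A" "a < ?w i" for i
    proof (cases "s' i \<le> s i")
      case True
      then have "G ?w i \<le> G s i" using i box[OF s(1)] w by (intro antitone) auto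
      also have "\<dots> \<le> c i" using True s i by (auto simp: S_def max_def)
      finally show ?thesis .
    next
      case False
      then have "G ?w i \<le> G s' i" using i box[OF s(2)] w by (intro antitone) auto
      also have "\<dots> \<le> c i" using False s i by (auto simp: S_def max_def)
      finally show ?thesis .
    qed
    with w show ?thesis by (auto simp: S_def)
  qed
  have approx: "\<exists>s\<in>S. \<forall>i\<in>F. t i - e < s i" if "finite F" "F \<subseteq> A" "0 < e" for F e
    using that
  proof (induction F)
    case empty
    then show ?case using bot by auto
  next
    case (insert i F)
    then obtain s where s: "s \<in> S" "\<forall>i\<in>F. t i - e < s i" by auto
    have "t i - e < Sup ((\<lambda>s. s i) ` S)" using insert.prems by (simp add: t_def)
    then obtain s' where s': "s' \<in> S" "t i - e < s' i"
      using less_cSupD[of "(\<lambda>s. s i) ` S" "t i - e"] bot by auto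
    show ?case
      using s s' by (intro bexI[OF _ sup_mem[OF s(1) s'(1)]]) (auto simp: less_max_iff_disj)
  qed
  have "\<exists>s\<in>S. \<forall>i\<in>A. t i - 1 / real (Suc k) < s i" for k
    by (rule approx) (use A in auto)
  then obtain s where s: "\<And>k. s k \<in> S" "\<And>k i. i \<in> A \<Longrightarrow> t i - 1 / real (Suc k) < s k i"
    by metis
  have lim: "(\<lambda>k. s k i) \<longlonglongrightarrow> t i" if i: "i \<in> A" for i
  proof (rule real_tendsto_sandwich)
    show "\<forall>\<^sub>F k in sequentially. t i - 1 / real (Suc k) \<le> s k i"
      by (intro always_eventually allI less_imp_le s(2) i)
    show "\<forall>\<^sub>F k in sequentially. s k i \<le> t i" using upper[OF s(1) i] by auto
    show "(\<lambda>k. t i - 1 / real (Suc k)) \<longlonglongrightarrow> t i"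
      using tendsto_diff[OF tendsto_const[of "t i"] LIMSEQ_Suc[OF lim_1_over_n]] by simp
  qed simp
  have sub: "G t i \<le> c i" if i: "i \<in> A" "a < t i" for i
  proof (rule tendsto_upperbound)
    show "(\<lambda>k. G (s k) i) \<longlonglongrightarrow> G t i"
      using box[OF s(1)] t_box lim i by (intro cont) auto
    show "\<forall>\<^sub>F k in sequentially. G (s k) i \<le> c i"
      using order_tendstoD(1)[OF lim[OF i(1)] i(2)]
      by eventually_elim (use s(1) i(1) in \<open>auto simp: S_def\<close>)
  qed simp
  have super: "c i \<le> G t i" if i: "i \<in> A" "t i < b" for i
  proof (rule ccontr)
    assume "\<not> c i \<le> G t i"
    then have less: "G t i < c i" by simp
    define r where "r k = t(i := t i + (b - t i) / real (Suc k))" for k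
    have r_box: "r k \<in> A \<rightarrow> {a..b}" for k
    proof
      fix j assume j: "j \<in> A"
      have "t i + (b - t i) / real (Suc k) \<le> b"
        using i(2) mult_right_mono[of 1 "real (Suc k)" "b - t i"]
        by (simp add: field_simps)
      moreover have "a \<le> t i + (b - t i) / real (Suc k)"
        using i t_box by (intro add_increasing2) auto
      moreover have "t j \<in> {a..b}" using t_box j by auto
      ultimately show "r k j \<in> {a..b}"
        unfolding r_def fun_upd_apply by (simp del: of_nat_Suc)
    qed
    have "(\<lambda>k. t i + (b - t i) * (1 / real (Suc k))) \<longlonglongrightarrow> t i + (b - t i) * 0"
      by (intro tendsto_intros LIMSEQ_Suc[OF lim_1_over_n])
    then have "(\<lambda>k. r k j) \<longlonglongrightarrow> t j" for j by (cases "j = i") (auto simp: r_def)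
    then have "(\<lambda>k. G (r k) i) \<longlonglongrightarrow> G t i"
      using r_box t_box i by (intro cont) auto
    then have "\<forall>\<^sub>F k in sequentially. G (r k) i < c i"
      using less by (rule order_tendstoD(2))
    then obtain k where k: "G (r k) i < c i" by (auto dest: eventually_happens)
    have le: "t j \<le> r k j" for j using i(2) by (auto simp: r_def)
    have other: "G (r k) j \<le> c j" if j: "j \<in> A" "a < r k j" "j \<noteq> i" for j
    proof -
      have eq: "t j = r k j" using j by (simp add: r_def)
      then have "G (r k) j \<le> G t j" using r_box t_box le j by (intro antitone) auto
      also have "\<dots> \<le> c j" using sub j eq by simp
      finally show ?thesis .
    qed
    have "G (r k) j \<le> c j" if "j \<in> A" "a < r k j" for j
      using other[OF that] k by (cases "j = i") auto
    then have "r k \<in> S" unfolding S_def using r_box by blast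
    then have "r k i \<le> t i" using i(1) by (rule upper)
    then have "(b - t i) / real (Suc k) \<le> 0" by (simp add: r_def del: of_nat_Suc)
    moreover have "0 < (b - t i) / real (Suc k)" using i(2) by simp
    ultimately show False by linarith
  qed
  show ?thesis by (rule that[OF t_box sub super])
qed


text \<open>The \<open>card J + 1\<close> open intervals between consecutive powers of \<open>q\<close> are disjoint, so the
  \<open>card J\<close> values of \<open>b\<close> cannot meet all of them.\<close>

lemma geometric_gap:
  fixes b :: "'i \<Rightarrow> real" and q :: real
  assumes J: "finite J" and q: "1 < q"
  obtains (gap) k where "k \<le> card J" "\<And>j. j \<in> J \<Longrightarrow> b j \<le> q ^ k \<or> q ^ Suc k \<le> b j"
proof (rule ccontr)
  assume "\<not> thesis"
  then have "\<exists>j\<in>J. q ^ k < b j \<and> b j < q ^ Suc k" if "k \<le> card J" for k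
    using that gap[of k] by (meson not_le)
  then obtain f where f: "\<And>k. k \<le> card J \<Longrightarrow> f k \<in> J \<and> q ^ k < b (f k) \<and> b (f k) < q ^ Suc k"
    by metis
  have "inj_on f {..card J}"
  proof (rule linorder_inj_onI)
    fix k l assume kl: "k < l" "k \<in> {..card J}" "l \<in> {..card J}"
    have "q ^ Suc k \<le> q ^ l" using q kl by (intro power_increasing) auto
    then have "b (f k) < b (f l)" using f[of k] f[of l] kl by auto
    then show "f k \<noteq> f l" by auto
  qed auto
  then have "card {..card J} \<le> card J"
    using J f by (intro card_inj_on_le) auto
  then show False by simp
qed

section \<open>Facts on spheres, convex hulls and radial functions\<close>

lemma great_sphere_null:
  fixes w :: "real ^ 'n"
  assumes "w \<noteq> 0"
  shows "{u \<in> sphere 0 1. u \<bullet> w = 0} \<in> null_sets spherical_lebesgue"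
proof -
  let ?A = "{u \<in> sphere 0 1. u \<bullet> w = 0}" and ?H = "{x. w \<bullet> x = 0}"
  have "?A = sphere 0 1 \<inter> {u. u \<bullet> w = 0}" by auto
  moreover have "closed \<dots>"
    by (intro closed_Int closed_Collect_eq continuous_intros closed_sphere)
  ultimately have "closed ?A" by simp
  then have A: "?A \<in> sets borel_sphere"
    by (auto simp: sets_restrict_space_iff)
  have H: "?H \<in> sets borel"
    by (intro borel_closed closed_hyperplane)
  have "?H \<in> null_sets lebesgue"
    using negligible_hyperplane[of w 0] assms negligible_iff_null_sets by blast
  then have "emeasure lborel ?H = 0"
    using H by (simp add: null_sets_completion_iff null_setsD1)
  moreover have "emeasure lborel {t *\<^sub>R u | t u. 0 < t \<and> t \<le> 1 \<and> u \<in> ?A} \<le> emeasure lborel ?H"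
    using H by (intro emeasure_mono) (auto simp: inner_commute)
  ultimately have "emeasure lborel {t *\<^sub>R u | t u. 0 < t \<and> t \<le> 1 \<and> u \<in> ?A} = 0"
    by simp
  then have "emeasure spherical_lebesgue ?A = 0"
    unfolding emeasure_spherical_lebesgue[OF A] by simp
  moreover have "?A \<in> sets spherical_lebesgue"
    using A by (simp add: spherical_lebesgue_def)
  ultimately show ?thesis by (rule null_setsI)
qed

text \<open>The sum of the positive parts of the \<open>u \<bullet> w i\<close> is continuous and positive on the compact
  sphere, and at each point the largest summand is at least the average.\<close>

lemma uniform_margin:
  fixes w :: "'i \<Rightarrow> 'a :: euclidean_space"
  assumes I: "finite I" and pos: "\<And>u. norm u = 1 \<Longrightarrow> \<exists>i\<in>I. 0 < u \<bullet> w i"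
  obtains d where "0 < d" "\<And>u. norm u = 1 \<Longrightarrow> \<exists>i\<in>I. d < u \<bullet> w i"
proof -
  let ?f = "\<lambda>u. \<Sum>i\<in>I. max 0 (u \<bullet> w i)"
  have "sphere 0 1 \<noteq> ({} :: 'a set)" by simp
  moreover have "continuous_on (sphere 0 1) ?f"
    by (intro continuous_intros)
  ultimately have "\<exists>u0\<in>sphere 0 1. \<forall>u\<in>sphere 0 1. ?f u0 \<le> ?f u"
    by (rule continuous_attains_inf[OF compact_sphere])
  then obtain u0 where u0: "u0 \<in> sphere 0 1" "\<And>u. u \<in> sphere 0 1 \<Longrightarrow> ?f u0 \<le> ?f u"
    by blast
  obtain i where i: "i \<in> I" "0 < u0 \<bullet> w i" using pos[of u0] u0(1) by auto
  then have f_pos: "0 < ?f u0" using I by (intro sum_pos2[of I i]) auto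
  define d where "d = ?f u0 / (2 * real (card I))"
  have card: "0 < real (card I)" using i I by (auto simp: card_gt_0_iff)
  have d: "0 < d" using f_pos card by (simp add: d_def)
  have margin: "\<exists>i\<in>I. d < u \<bullet> w i" if "norm u = 1" for u
  proof (rule ccontr)
    assume "\<not> (\<exists>i\<in>I. d < u \<bullet> w i)"
    then have "max 0 (u \<bullet> w i) \<le> d" if "i \<in> I" for i using d that by (simp add: not_less)
    then have "?f u \<le> real (card I) * d" by (intro sum_bounded_above)
    also have "\<dots> = ?f u0 / 2" using card by (simp add: d_def)
    also have "\<dots> < ?f u0" using f_pos by simp
    finally show False using u0(2)[of u] that by simp
  qed
  show ?thesis by (rule that[OF d]) (rule margin)
qed

text \<open>A linear functional with a strict maximum over a finite set exposes that point of the hull: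
  the defect \<open>p \<bullet> u - y \<bullet> u\<close> is the average of the defects of the points of \<open>S\<close>.\<close>

lemma convex_hull_unique_maximizer:
  fixes S :: "'a :: real_inner set"
  assumes S: "finite S" "p \<in> S" and less: "\<And>x. x \<in> S \<Longrightarrow> x \<noteq> p \<Longrightarrow> x \<bullet> u < p \<bullet> u"
    and y: "y \<in> convex hull S"
  shows "y \<bullet> u \<le> p \<bullet> u" and "y \<bullet> u = p \<bullet> u \<Longrightarrow> y = p"
proof -
  from y obtain w where w: "\<And>x. x \<in> S \<Longrightarrow> 0 \<le> w x" "sum w S = 1" "y = (\<Sum>x\<in>S. w x *\<^sub>R x)"
    unfolding convex_hull_finite[OF S(1)] by auto
  have le: "x \<bullet> u \<le> p \<bullet> u" if "x \<in> S" for x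
    using less[OF that] by (cases "x = p") auto
  have gap: "p \<bullet> u - y \<bullet> u = (\<Sum>x\<in>S. w x * (p \<bullet> u - x \<bullet> u))"
    by (simp add: w(3) inner_sum_left right_diff_distrib sum_subtractf w(2)
        flip: sum_distrib_right)
  have nonneg: "0 \<le> w x * (p \<bullet> u - x \<bullet> u)" if "x \<in> S" for x
    using w(1)[OF that] le[OF that] by simp
  have "0 \<le> (\<Sum>x\<in>S. w x * (p \<bullet> u - x \<bullet> u))" by (intro sum_nonneg nonneg)
  then show "y \<bullet> u \<le> p \<bullet> u" by (simp flip: gap)
  assume "y \<bullet> u = p \<bullet> u"
  then have zero: "w x * (p \<bullet> u - x \<bullet> u) = 0" if "x \<in> S" for x
    using gap that sum_nonneg_eq_0_iff[OF S(1), of "\<lambda>x. w x * (p \<bullet> u - x \<bullet> u)", OF nonneg] by simp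
  have w0: "w x = 0" if "x \<in> S - {p}" for x
    using zero[of x] less[of x] that by auto
  have "sum w S = w p" using S w0 by (subst sum.remove[of S p]) auto
  moreover have "(\<Sum>x\<in>S. w x *\<^sub>R x) = w p *\<^sub>R p"
    using S w0 by (subst sum.remove[of S p]) auto
  ultimately show "y = p" using w by simp
qed

lemma radial_map_mem:
  fixes P :: "(real ^ 'n) set"
  assumes P: "compact P" "0 \<in> P" and w: "norm w = 1"
  shows "0 \<le> radial_function P w" and "radial_map P w \<in> P"
proof -
  let ?A = "{a. a *\<^sub>R w \<in> P}"
  have "closed ((\<lambda>a. a *\<^sub>R w) -` P)"
    using P(1) by (intro closed_vimage compact_imp_closed continuous_intros) auto
  then have "closed ?A" by (simp add: vimage_def)
  moreover obtain B where B: "\<And>y. y \<in> P \<Longrightarrow> norm y \<le> B"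
    using compact_imp_bounded[OF P(1)] by (auto simp: bounded_iff)
  have "bounded ?A"
    unfolding bounded_iff using B w by (intro exI[of _ B] ballI) fastforce
  ultimately have "compact ?A" by (simp add: compact_eq_bounded_closed)
  moreover have zero: "0 \<in> ?A" using P(2) by simp
  ultimately obtain a where a: "a \<in> ?A" "\<And>a'. a' \<in> ?A \<Longrightarrow> a' \<le> a"
    using compact_attains_sup[of ?A] by blast
  (* The operator GREATEST has a meaning only once a maximum is known to be attained. *)
  have "radial_function P w = a"
    unfolding radial_function_def by (rule Greatest_equality) (use a in auto)
  then show "0 \<le> radial_function P w" "radial_map P w \<in> P"
    using a zero by (auto simp: radial_map_def)
qed

section \<open>Cells of normal directions\<close>

text \<open>The last assumption is the analytic form of the condition that no closed hemisphere contains
  all the directions.\<close>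

locale spread_directions =
  fixes J :: "'i set" and v :: "'i \<Rightarrow> real ^ 'n"
  assumes finite_J: "finite J"
    and inj_v: "inj_on v J"
    and norm_v: "j \<in> J \<Longrightarrow> norm (v j) = 1"
    and spread: "norm u = 1 \<Longrightarrow> \<exists>j\<in>J. 0 < u \<bullet> v j"
begin

text \<open>For \<open>i \<in> J\<close> this is the set of unit normals of the hull of the \<open>b j *\<^sub>R v j\<close> at
  \<open>b i *\<^sub>R v i\<close>.\<close>

definition vertex_cell :: "('i \<Rightarrow> real) \<Rightarrow> 'i \<Rightarrow> (real ^ 'n) set" where
  "vertex_cell b i = {u \<in> sphere 0 1. \<forall>j\<in>J. b j * (u \<bullet> v j) \<le> b i * (u \<bullet> v i)}"

text \<open>The normal directions for which some two of the scaled directions tie, written as a union of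
  great subspheres. All pairs of indices count, not only the maximising ones; the set may be
  larger than the overlap of the cells, but it is still null for positive weights.\<close>

definition tie_set :: "('i \<Rightarrow> real) \<Rightarrow> (real ^ 'n) set" where
  "tie_set b = (\<Union>i\<in>J. \<Union>j\<in>J - {i}. {u \<in> sphere 0 1. u \<bullet> (b i *\<^sub>R v i - b j *\<^sub>R v j) = 0})"

lemma vertex_cell_subset: "vertex_cell b i \<subseteq> sphere 0 1"
  by (auto simp: vertex_cell_def)

lemma vertex_cell_measurable: "vertex_cell b i \<in> sets borel_sphere"
proof -
  have "vertex_cell b i = sphere 0 1 \<inter> (\<Inter>j\<in>J. {u. b j * (u \<bullet> v j) \<le> b i * (u \<bullet> v i)})"
    by (auto simp: vertex_cell_def)
  moreover have "closed \<dots>"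
    by (intro closed_Int closed_INT ballI closed_Collect_le continuous_intros closed_sphere)
  ultimately show ?thesis
    using vertex_cell_subset by (auto simp: sets_restrict_space_iff)
qed

lemma vertex_cells_cover: "(\<Union>i\<in>J. vertex_cell b i) = sphere 0 1"
proof (intro subset_antisym subsetI)
  fix u :: "real ^ 'n" assume u: "u \<in> sphere 0 1"
  let ?f = "\<lambda>i. b i * (u \<bullet> v i)"
  have "J \<noteq> {}" using spread[of u] u by auto
  then have "Max (?f ` J) \<in> ?f ` J" using finite_J by (intro Max_in) auto
  then obtain i where i: "i \<in> J" "Max (?f ` J) = ?f i" by (rule imageE)
  have "?f j \<le> ?f i" if "j \<in> J" for j
    unfolding i(2)[symmetric] using that finite_J by (intro Max_ge) auto
  then have "u \<in> vertex_cell b i"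
    using u by (auto simp: vertex_cell_def)
  with i show "u \<in> (\<Union>i\<in>J. vertex_cell b i)" by blast
qed (auto simp: vertex_cell_def)

lemma inner_pos_on_vertex_cell:
  assumes b: "\<And>j. j \<in> J \<Longrightarrow> 0 < b j" and "i \<in> J" "u \<in> vertex_cell b i"
  shows "0 < u \<bullet> v i"
proof -
  obtain j where j: "j \<in> J" "0 < u \<bullet> v j"
    using spread[of u] assms by (auto simp: vertex_cell_def)
  then have "0 < b j * (u \<bullet> v j)" using b by simp
  also have "\<dots> \<le> b i * (u \<bullet> v i)" using assms j by (auto simp: vertex_cell_def)
  finally show ?thesis using b[OF \<open>i \<in> J\<close>] by (simp add: zero_less_mult_iff)
qed

text \<open>A direction with \<open>u \<bullet> v j < 0\<close> would become a weaker competitor when \<open>b j\<close> grows; it does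
  no harm, since by the spread of the directions the winning value is positive.\<close>

lemma vertex_cell_antitone:
  assumes b: "\<And>j. j \<in> J \<Longrightarrow> 0 < b j" and le: "\<And>j. j \<in> J \<Longrightarrow> b j \<le> b' j"
    and i: "i \<in> J" "b i = b' i"
  shows "vertex_cell b' i \<subseteq> vertex_cell b i"
proof
  fix u assume u: "u \<in> vertex_cell b' i"
  have b': "0 < b' j" if "j \<in> J" for j using b le that by force
  have pos: "0 < u \<bullet> v i" by (rule inner_pos_on_vertex_cell[of b']) (use b' i u in auto)
  have "b j * (u \<bullet> v j) \<le> b i * (u \<bullet> v i)" if j: "j \<in> J" for j
  proof (cases "0 \<le> u \<bullet> v j")
    case True
    then have "b j * (u \<bullet> v j) \<le> b' j * (u \<bullet> v j)" using le[OF j] by (rule mult_right_mono[rotated])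
    also have "\<dots> \<le> b i * (u \<bullet> v i)" using u j i by (auto simp: vertex_cell_def)
    finally show ?thesis .
  next
    case False
    then have "b j * (u \<bullet> v j) \<le> 0" using b[OF j] by (simp add: mult_le_0_iff)
    also have "0 \<le> b i * (u \<bullet> v i)" using b[OF i(1)] pos by simp
    finally show ?thesis .
  qed
  then show "u \<in> vertex_cell b i" using u by (auto simp: vertex_cell_def)
qed

lemma strict_on_vertex_cell:
  assumes "i \<in> J" "u \<in> vertex_cell b i" "u \<notin> tie_set b" "j \<in> J" "j \<noteq> i"
  shows "b j * (u \<bullet> v j) < b i * (u \<bullet> v i)"
proof -
  have "u \<bullet> (b i *\<^sub>R v i - b j *\<^sub>R v j) \<noteq> 0"
    using assms by (auto simp: tie_set_def vertex_cell_def)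
  then have "b j * (u \<bullet> v j) \<noteq> b i * (u \<bullet> v i)" by (simp add: inner_diff_right)
  then show ?thesis using assms by (auto simp: vertex_cell_def less_le)
qed

lemma scaled_directions_distinct:
  assumes "i \<in> J" "j \<in> J" "i \<noteq> j" "0 < b i" "0 < b j"
  shows "b i *\<^sub>R v i \<noteq> b j *\<^sub>R v j"
proof
  assume eq: "b i *\<^sub>R v i = b j *\<^sub>R v j"
  then have "norm (b i *\<^sub>R v i) = norm (b j *\<^sub>R v j)" by simp
  then have "b i = b j" using assms norm_v by simp
  then have "v i = v j" using eq assms by simp
  then have "i = j" using inj_onD[OF inj_v] assms(1,2) by simp
  then show False using assms(3) by simp
qed

lemma tie_set_null:
  assumes b: "\<And>j. j \<in> J \<Longrightarrow> 0 < b j"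
  shows "tie_set b \<in> null_sets spherical_lebesgue"
  unfolding tie_set_def
proof (intro null_sets_UN' great_sphere_null countable_finite)
  fix i j assume "i \<in> J" "j \<in> J - {i}"
  then have ij: "i \<in> J" "j \<in> J" "i \<noteq> j" by blast+
  have "b i *\<^sub>R v i \<noteq> b j *\<^sub>R v j"
    by (rule scaled_directions_distinct[OF ij b[OF ij(1)] b[OF ij(2)]])
  then show "b i *\<^sub>R v i - b j *\<^sub>R v j \<noteq> 0" by simp
qed (use finite_J in simp_all)

definition hull_of_scaled :: "('i \<Rightarrow> real) \<Rightarrow> (real ^ 'n) set" where
  "hull_of_scaled b = convex hull ((\<lambda>i. b i *\<^sub>R v i) ` J)"

lemma compact_hull_of_scaled: "compact (hull_of_scaled b)"
  unfolding hull_of_scaled_def using finite_J by (intro finite_imp_compact_convex_hull) simp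

lemma zero_mem_hull_of_scaled:
  assumes b: "\<And>j. j \<in> J \<Longrightarrow> 0 < b j"
  shows "0 \<in> hull_of_scaled b"
proof (rule ccontr)
  assume "0 \<notin> hull_of_scaled b"
  then obtain a e where a: "a \<noteq> 0" "0 < e" "\<And>x. x \<in> hull_of_scaled b \<Longrightarrow> e < a \<bullet> x"
    using separating_hyperplane_closed_0[of "hull_of_scaled b"]
      compact_imp_closed[OF compact_hull_of_scaled] convex_convex_hull
    unfolding hull_of_scaled_def by blast
  have "norm (- (a /\<^sub>R norm a)) = 1" using a(1) by simp
  then obtain j where j: "j \<in> J" "0 < - (a /\<^sub>R norm a) \<bullet> v j" using spread by blast
  then have "b j *\<^sub>R v j \<in> hull_of_scaled b"
    unfolding hull_of_scaled_def by (intro hull_inc) auto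
  then have "0 < a \<bullet> (b j *\<^sub>R v j)" using a(2,3) by force
  then have "0 < a \<bullet> v j" using b[OF j(1)] by (simp add: zero_less_mult_iff)
  moreover have "a \<bullet> v j < 0" using j(2) a(1) by (simp add: zero_less_mult_iff mult_less_0_iff)
  ultimately show False by simp
qed

text \<open>Off the tie set, the face of the hull with outer normal \<open>u\<close> is the single vertex
  \<open>b i *\<^sub>R v i\<close>, and among the unit vectors only \<open>v i\<close> is mapped to this vertex by the radial
  map.\<close>

lemma mem_radial_Gauss_image_iff:
  assumes b: "\<And>j. j \<in> J \<Longrightarrow> 0 < b j" and i: "i \<in> J"
    and u: "u \<in> vertex_cell b i" "u \<notin> tie_set b" and \<omega>: "\<omega> \<subseteq> sphere 0 1"
  shows "u \<in> radial_Gauss_image (hull_of_scaled b) \<omega> \<longleftrightarrow> v i \<in> \<omega>"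
proof -
  let ?P = "hull_of_scaled b" and ?p = "b i *\<^sub>R v i"
  have p: "?p \<in> ?P" unfolding hull_of_scaled_def using i by (intro hull_inc) auto
  have S: "finite ((\<lambda>i. b i *\<^sub>R v i) ` J)" "?p \<in> (\<lambda>i. b i *\<^sub>R v i) ` J"
    using finite_J i by auto
  have less: "x \<bullet> u < ?p \<bullet> u" if x: "x \<in> (\<lambda>i. b i *\<^sub>R v i) ` J" "x \<noteq> ?p" for x
  proof -
    obtain j where j: "j \<in> J" "x = b j *\<^sub>R v j" using x(1) by blast
    then have "j \<noteq> i" using x(2) by blast
    then show ?thesis
      using strict_on_vertex_cell[OF i u j(1)] by (simp add: j(2) inner_commute)
  qed
  note max = convex_hull_unique_maximizer[OF S less, folded hull_of_scaled_def]
  have u_pos: "0 < u \<bullet> v i" by (rule inner_pos_on_vertex_cell[of b]) (use b i u in auto)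
  show ?thesis
  proof
    assume "u \<in> radial_Gauss_image ?P \<omega>"
    then obtain w where w: "w \<in> \<omega>" "u \<in> normal_cone ?P (radial_map ?P w)"
      by (auto simp: radial_Gauss_image_def)
    have norm_w: "norm w = 1" using w(1) \<omega> by auto
    note radial = radial_map_mem[OF compact_hull_of_scaled[of b] zero_mem_hull_of_scaled[of b, OF b] norm_w]
    have "(?p - radial_map ?P w) \<bullet> u \<le> 0"
      using w(2) p unfolding normal_cone_def by blast
    then have "?p \<bullet> u \<le> radial_map ?P w \<bullet> u" by (simp add: inner_diff_left)
    then have eq: "radial_map ?P w = ?p"
      using max[OF _ _ radial(2)] by simp
    then have "norm (radial_map ?P w) = norm ?p" by simp
    then have "radial_function ?P w = b i"
      using radial(1) b[OF i] norm_w norm_v[OF i] by (simp add: radial_map_def)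
    then have "w = v i" using eq b[OF i] by (simp add: radial_map_def)
    then show "v i \<in> \<omega>" using w(1) by simp
  next
    assume vi: "v i \<in> \<omega>"
    have "radial_function ?P (v i) = b i"
      unfolding radial_function_def
    proof (rule Greatest_equality)
      fix a assume "a *\<^sub>R v i \<in> ?P"
      then have "a *\<^sub>R v i \<bullet> u \<le> ?p \<bullet> u" by (intro max(1)) auto
      then show "a \<le> b i" using u_pos by (simp add: inner_commute)
    qed (rule p)
    then have "radial_map ?P (v i) = ?p" by (simp add: radial_map_def)
    moreover have "(y - ?p) \<bullet> u \<le> 0" if "y \<in> ?P" for y
      using max(1)[OF _ _ that] by (simp add: inner_diff_left)
    ultimately have "u \<in> normal_cone ?P (radial_map ?P (v i))"
      using u(1) by (auto simp: normal_cone_def vertex_cell_def)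
    then show "u \<in> radial_Gauss_image ?P \<omega>"
      using vi by (auto simp: radial_Gauss_image_def)
  qed
qed

end

section \<open>Measures of cells\<close>

locale spread_directions_measure = spread_directions J v
  for J :: "'i set" and v :: "'i \<Rightarrow> real ^ 'n" +
  fixes M :: "(real ^ 'n) measure"
  assumes sets_M: "sets M = sets borel_sphere"
    and ac: "absolutely_continuous spherical_lebesgue M"
    and finite_M: "finite_measure M"
begin

sublocale finite_measure M by (rule finite_M)

lemma space_M: "space M = sphere 0 1"
  using sets_eq_imp_space_eq[OF sets_M] by (simp add: space_restrict_space)

lemma vertex_cell_sets: "vertex_cell b i \<in> sets M"
  using vertex_cell_measurable by (simp add: sets_M)

lemma tie_set_null_M: "(\<And>j. j \<in> J \<Longrightarrow> 0 < b j) \<Longrightarrow> tie_set b \<in> null_sets M"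
  using tie_set_null ac by (auto simp: absolutely_continuous_def)

lemma AE_not_tie: "(\<And>j. j \<in> J \<Longrightarrow> 0 < b j) \<Longrightarrow> AE u in M. u \<notin> tie_set b"
  using tie_set_null_M by (intro AE_not_in) auto

lemma measure_Union_vertex_cells:
  assumes b: "\<And>j. j \<in> J \<Longrightarrow> 0 < b j" and I: "I \<subseteq> J"
  shows "measure M (\<Union>i\<in>I. vertex_cell b i) = (\<Sum>i\<in>I. measure M (vertex_cell b i))"
proof (rule measure_UNION_AE)
  show "finite I" using I finite_J finite_subset by blast
  show "pairwise (\<lambda>i j. AE u in M. u \<notin> vertex_cell b i \<or> u \<notin> vertex_cell b j) I"
  proof (rule pairwiseI)
    fix i j assume ij: "i \<in> I" "j \<in> I" "i \<noteq> j"
    have disj: "u \<notin> vertex_cell b i \<or> u \<notin> vertex_cell b j" if "u \<notin> tie_set b" for u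
      using strict_on_vertex_cell[of i u b j] strict_on_vertex_cell[of j u b i] ij I that
      by force
    have "AE u in M. u \<notin> tie_set b" by (rule AE_not_tie) (rule b)
    then show "AE u in M. u \<notin> vertex_cell b i \<or> u \<notin> vertex_cell b j"
      by eventually_elim (rule disj)
  qed
qed (simp add: fmeasurable_eq_sets vertex_cell_sets)

text \<open>Off the tie set of the limit, membership in the cell is decided by strict inequalities, which
  persist for nearby weights. So the indicator functions converge almost everywhere, and dominated
  convergence applies.\<close>

lemma measure_vertex_cell_tendsto:
  assumes t: "\<And>j. j \<in> J \<Longrightarrow> 0 < t j"
    and lim: "\<And>j. j \<in> J \<Longrightarrow> (\<lambda>k::nat. s k j) \<longlonglongrightarrow> t j" and i: "i \<in> J"
  shows "(\<lambda>k. measure M (vertex_cell (s k) i)) \<longlonglongrightarrow> measure M (vertex_cell t i)"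
proof -
  let ?g = "\<lambda>b. indicat_real (vertex_cell b i)"
  have int: "integral\<^sup>L M (?g b) = measure M (vertex_cell b i)" for b
    using sets.sets_into_space[OF vertex_cell_sets] by (simp add: Int_absorb2)
  have val: "(\<lambda>k. s k j * (u \<bullet> v j)) \<longlonglongrightarrow> t j * (u \<bullet> v j)" if "j \<in> J" for u j
    using lim[OF that] by (intro tendsto_intros)
  have eventually_less: "\<forall>\<^sub>F k in sequentially. s k j * (u \<bullet> v j) < s k j' * (u \<bullet> v j')"
    if "j \<in> J" "j' \<in> J" "t j * (u \<bullet> v j) < t j' * (u \<bullet> v j')" for u j j'
    using order_tendstoD(1)[OF tendsto_diff[OF val[OF that(2)] val[OF that(1)]], of 0 u u] that(3)
    by simp
  have pointwise: "(\<lambda>k. ?g (s k) u) \<longlonglongrightarrow> ?g t u" if u: "u \<in> space M" "u \<notin> tie_set t" for u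
  proof (cases "u \<in> vertex_cell t i")
    case True
    have "\<forall>\<^sub>F k in sequentially. s k j * (u \<bullet> v j) \<le> s k i * (u \<bullet> v i)" if j: "j \<in> J" for j
    proof (cases "j = i")
      case False
      then have "t j * (u \<bullet> v j) < t i * (u \<bullet> v i)"
        using strict_on_vertex_cell[of i u t j] True u j i by auto
      then have "\<forall>\<^sub>F k in sequentially. s k j * (u \<bullet> v j) < s k i * (u \<bullet> v i)"
        by (rule eventually_less[OF j i])
      then show ?thesis by (auto elim: eventually_mono)
    qed simp
    then have "\<forall>\<^sub>F k in sequentially. \<forall>j\<in>J. s k j * (u \<bullet> v j) \<le> s k i * (u \<bullet> v i)"
      using finite_J by (intro eventually_ball_finite) auto
    then show ?thesis
      using True u by (intro tendsto_eventually) (auto elim!: eventually_mono simp: vertex_cell_def)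
  next
    case False
    then obtain j where j: "j \<in> J" "t i * (u \<bullet> v i) < t j * (u \<bullet> v j)"
      using u by (auto simp: vertex_cell_def space_M not_le)
    have "\<forall>\<^sub>F k in sequentially. s k i * (u \<bullet> v i) < s k j * (u \<bullet> v j)"
      by (rule eventually_less[OF i j])
    then have "\<forall>\<^sub>F k in sequentially. u \<notin> vertex_cell (s k) i"
      using j(1) by (auto elim!: eventually_mono simp: vertex_cell_def not_le)
    then show ?thesis
      using False by (intro tendsto_eventually) (auto elim!: eventually_mono)
  qed
  have "(\<lambda>k. integral\<^sup>L M (?g (s k))) \<longlonglongrightarrow> integral\<^sup>L M (?g t)"
  proof (rule integral_dominated_convergence)
    have "AE u in M. u \<notin> tie_set t" by (rule AE_not_tie) (rule t)
    with AE_space show "AE u in M. (\<lambda>k. ?g (s k) u) \<longlonglongrightarrow> ?g t u"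
      by eventually_elim (rule pointwise)
    show "integrable M (\<lambda>_. 1 :: real)" by simp
    show "AE u in M. norm (?g (s k) u) \<le> 1" for k by simp
  qed (simp_all add: borel_measurable_indicator vertex_cell_sets)
  then show ?thesis by (simp only: int)
qed

text \<open>The margin hypothesis is a quantitative Hall condition: there is enough mass for the demand of
  the directions in \<open>I\<close> at angles bounded away from a right angle. This prevents the weights from
  degenerating: if those in \<open>I\<close> exceed all others by the factor \<open>1 / d\<close>, then the cells of \<open>I\<close>
  already receive their total demand, so nothing is gained by raising these weights further.\<close>

lemma prescribed_cell_measures:
  assumes total: "(\<Sum>i\<in>J. c i) = measure M (sphere 0 1)" and d: "0 < d" "d < 1"
    and margin: "\<And>I. I \<subseteq> J \<Longrightarrow> (\<Sum>i\<in>I. c i) \<le> measure M {u \<in> sphere 0 1. \<exists>i\<in>I. d < u \<bullet> v i}"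
  obtains b where "\<And>j. j \<in> J \<Longrightarrow> 0 < b j" "\<And>j. j \<in> J \<Longrightarrow> measure M (vertex_cell b j) = c j"
proof -
  define q where "q = 1 / d"
  have q: "1 < q" "q * d = 1" using d by (auto simp: q_def)
  (* The exponent makes room for card J + 1 disjoint gaps of ratio q in the box. *)
  define R where "R = q ^ Suc (card J)"
  define G where "G b i = measure M (vertex_cell b i)" for b i
  have R: "1 \<le> R" unfolding R_def using q(1) by (intro one_le_power) simp
  obtain b where box: "b \<in> J \<rightarrow> {1..R}"
    and sub: "\<And>i. \<lbrakk>i \<in> J; 1 < b i\<rbrakk> \<Longrightarrow> G b i \<le> c i"
    and super: "\<And>i. \<lbrakk>i \<in> J; b i < R\<rbrakk> \<Longrightarrow> c i \<le> G b i"
  proof (rule box_complementarity[OF finite_J R, of G c])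
    fix s :: "nat \<Rightarrow> 'i \<Rightarrow> real" and t i
    assume t: "t \<in> J \<rightarrow> {1..R}" and lim: "\<And>j. j \<in> J \<Longrightarrow> (\<lambda>k. s k j) \<longlonglongrightarrow> t j" and i: "i \<in> J"
    have "0 < t j" if "j \<in> J" for j using t that by force
    then show "(\<lambda>k. G (s k) i) \<longlonglongrightarrow> G t i"
      unfolding G_def using lim i by (rule measure_vertex_cell_tendsto)
  next
    fix s t :: "'i \<Rightarrow> real" and i
    assume st: "s \<in> J \<rightarrow> {1..R}" "\<And>j. j \<in> J \<Longrightarrow> s j \<le> t j" "i \<in> J" "s i = t i"
    have "0 < s j" if "j \<in> J" for j using st(1) that by force
    then have "vertex_cell t i \<subseteq> vertex_cell s i" using st(2-4) by (rule vertex_cell_antitone)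
    then show "G t i \<le> G s i"
      unfolding G_def by (intro finite_measure_mono vertex_cell_sets)
  qed blast
  have b: "0 < b j" if "j \<in> J" for j using box that by force
  obtain k where k: "k \<le> card J" "\<And>j. j \<in> J \<Longrightarrow> b j \<le> q ^ k \<or> q ^ Suc k \<le> b j"
    using geometric_gap[OF finite_J q(1)] by blast
  define I where "I = {j \<in> J. q ^ Suc k \<le> b j}"
  have IJ: "I \<subseteq> J" and fin: "finite I" using finite_J by (auto simp: I_def)
  (* Below the gap, the value b j * (u . v j) is at most q ^ k; above the gap, the margin d costs
     exactly one factor q and so leaves more than q ^ k. *)
  have covered: "{u \<in> sphere 0 1. \<exists>i\<in>I. d < u \<bullet> v i} \<subseteq> (\<Union>i\<in>I. vertex_cell b i)"
  proof
    fix u assume "u \<in> {u \<in> sphere 0 1. \<exists>i\<in>I. d < u \<bullet> v i}"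
    then obtain i where u: "norm u = 1" and i: "i \<in> I" "d < u \<bullet> v i" by auto
    have "u \<in> (\<Union>j\<in>J. vertex_cell b j)" using u by (simp add: vertex_cells_cover)
    then obtain j where j: "j \<in> J" "u \<in> vertex_cell b j" by blast
    have "j \<in> I"
    proof (rule ccontr)
      assume "j \<notin> I"
      then have small: "b j \<le> q ^ k" using k(2)[OF j(1)] j(1) by (auto simp: I_def)
      have "u \<bullet> v j \<le> 1" using norm_cauchy_schwarz[of u "v j"] u norm_v[OF j(1)] by simp
      then have "b j * (u \<bullet> v j) \<le> b j * 1" using b[OF j(1)] by (intro mult_left_mono) auto
      also have "\<dots> \<le> q ^ k" using small by simp
      also have "\<dots> = q ^ Suc k * d" using q(2) by (simp add: mult.assoc)
      also have "\<dots> < q ^ Suc k * (u \<bullet> v i)" using i(2) q(1) by (intro mult_strict_left_mono) auto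
      also have "\<dots> \<le> b i * (u \<bullet> v i)" using i d(1) by (intro mult_right_mono) (auto simp: I_def)
      also have "\<dots> \<le> b j * (u \<bullet> v j)" using j(2) i(1) IJ by (auto simp: vertex_cell_def)
      finally show False by simp
    qed
    then show "u \<in> (\<Union>i\<in>I. vertex_cell b i)" using j(2) by blast
  qed
  have "(\<Sum>i\<in>I. c i) \<le> measure M {u \<in> sphere 0 1. \<exists>i\<in>I. d < u \<bullet> v i}"
    by (rule margin[OF IJ])
  also have "\<dots> \<le> measure M (\<Union>i\<in>I. vertex_cell b i)"
    using covered fin by (intro finite_measure_mono sets.finite_UN vertex_cell_sets)
  also have "\<dots> = (\<Sum>i\<in>I. G b i)"
    unfolding G_def using b IJ by (rule measure_Union_vertex_cells)
  finally have ge: "(\<Sum>i\<in>I. c i) \<le> (\<Sum>i\<in>I. G b i)" .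
  have le: "G b i \<le> c i" if "i \<in> I" for i
  proof (rule sub)
    have "1 < q ^ Suc k" using q(1) by (intro one_less_power) auto
    then show "1 < b i" using that by (simp add: I_def)
  qed (use that IJ in blast)
  have sum_I: "(\<Sum>i\<in>I. G b i) = (\<Sum>i\<in>I. c i)"
    using ge sum_mono[of I "G b" c] le by force
  have "(\<Sum>i\<in>J. G b i) = (\<Sum>i\<in>J. c i)"
    using measure_Union_vertex_cells[of b J] b unfolding G_def total vertex_cells_cover by simp
  then have sum_rest: "(\<Sum>i\<in>J - I. c i) = (\<Sum>i\<in>J - I. G b i)"
    using sum_I by (simp add: sum_diff[OF finite_J IJ])
  have ge': "c i \<le> G b i" if "i \<in> J - I" for i
  proof (rule super)
    have "b i \<le> q ^ k" using k(2)[of i] that by (auto simp: I_def)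
    also have "\<dots> < R" unfolding R_def using q(1) k(1) by (intro power_strict_increasing) auto
    finally show "b i < R" .
  qed (use that in blast)
  have "G b j = c j" if "j \<in> J" for j
  proof (cases "j \<in> I")
    case True
    show ?thesis by (rule sum_mono_inv[OF sum_I le True fin])
  next
    case False
    have "c j = G b j"
      by (rule sum_mono_inv[OF sum_rest ge']) (use that False finite_J in auto)
    then show ?thesis by simp
  qed
  then show ?thesis using b by (intro that[of b]) (auto simp: G_def)
qed

text \<open>The radial Gauss image differs from a union of cells only inside the tie set. It need not
  be a Borel set, so the difference is a null set only for the completion.\<close>

lemma Gauss_image_measure_hull_of_scaled:
  assumes b: "\<And>j. j \<in> J \<Longrightarrow> 0 < b j" and \<omega>: "\<omega> \<subseteq> sphere 0 1"
  shows "Gauss_image_measure M (hull_of_scaled b) \<omega> =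
    ennreal (\<Sum>i | i \<in> J \<and> v i \<in> \<omega>. measure M (vertex_cell b i))"
proof -
  let ?I = "{i \<in> J. v i \<in> \<omega>}" and ?A = "radial_Gauss_image (hull_of_scaled b) \<omega>"
  let ?B = "\<Union>i\<in>?I. vertex_cell b i" and ?N = "completion M"
  have B: "?B \<in> sets M" using finite_J by (intro sets.finite_UN vertex_cell_sets) simp
  have "?A - ?B \<subseteq> tie_set b"
  proof
    fix u assume u: "u \<in> ?A - ?B"
    then have "u \<in> (\<Union>j\<in>J. vertex_cell b j)"
      unfolding vertex_cells_cover by (auto simp: radial_Gauss_image_def normal_cone_def)
    then obtain i where i: "i \<in> J" "u \<in> vertex_cell b i" by blast
    show "u \<in> tie_set b"
    proof (rule ccontr)
      assume "u \<notin> tie_set b"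
      then have "v i \<in> \<omega>" using mem_radial_Gauss_image_iff[OF b i _ \<omega>] u by blast
      then show False using i u by blast
    qed
  qed
  moreover have "?B - ?A \<subseteq> tie_set b"
  proof
    fix u assume u: "u \<in> ?B - ?A"
    then obtain i where i: "i \<in> J" "u \<in> vertex_cell b i" "v i \<in> \<omega>" by blast
    then show "u \<in> tie_set b" using mem_radial_Gauss_image_iff[OF b i(1,2) _ \<omega>] u by blast
  qed
  moreover have "tie_set b \<in> null_sets ?N"
    by (intro null_sets_completionI tie_set_null_M b)
  ultimately have null: "?A - ?B \<in> null_sets ?N" "?B - ?A \<in> null_sets ?N"
    using null_sets_completion_subset by blast+
  have B': "?B \<in> sets ?N" using B by (rule sets_completionI_sets)
  have "?A = (?B - (?B - ?A)) \<union> (?A - ?B)" by blast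
  then have "emeasure ?N ?A = emeasure ?N ((?B - (?B - ?A)) \<union> (?A - ?B))" by simp
  also have "\<dots> = emeasure ?N (?B - (?B - ?A))"
    by (rule emeasure_Un_null_set[OF sets.Diff[OF B' null_setsD2[OF null(2)]] null(1)])
  also have "\<dots> = emeasure ?N ?B" by (rule emeasure_Diff_null_set[OF null(2) B'])
  also have "\<dots> = emeasure M ?B" using B by simp
  also have "\<dots> = ennreal (measure M ?B)" by (rule emeasure_eq_measure)
  also have "measure M ?B = (\<Sum>i\<in>?I. measure M (vertex_cell b i))"
    using b by (rule measure_Union_vertex_cells) auto
  finally show ?thesis by (simp add: Gauss_image_measure_def)
qed

end

section \<open>Discrete measures and the weak Aleksandrov relation\<close>

lemma emeasure_discrete_on_sphere:
  assumes "discrete_on_sphere \<mu> m c v" "A \<in> sets borel_sphere"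
  shows "emeasure \<mu> A = ennreal (\<Sum>i | i \<in> {1..m} \<and> v i \<in> A. c i)"
proof -
  have "emeasure \<mu> A = (\<Sum>i=1..m. ennreal (c i) * emeasure (return borel_sphere (v i)) A)"
    using assms by (simp add: discrete_on_sphere_def)
  also have "\<dots> = (\<Sum>i=1..m. if v i \<in> A then ennreal (c i) else 0)"
    using assms(2) by (intro sum.cong) (auto simp: emeasure_return)
  also have "\<dots> = (\<Sum>i | i \<in> {1..m} \<and> v i \<in> A. ennreal (c i))"
    by (rule sum.inter_filter[symmetric]) simp
  also have "\<dots> = ennreal (\<Sum>i | i \<in> {1..m} \<and> v i \<in> A. c i)"
    using assms(1) by (intro sum_ennreal) (auto simp: discrete_on_sphere_def intro: less_imp_le)
  finally show ?thesis .
qed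

lemma emeasure_discrete_on_sphere_total:
  assumes "discrete_on_sphere \<mu> m c v"
  shows "emeasure \<mu> (sphere 0 1) = ennreal (\<Sum>i\<in>{1..m}. c i)"
proof -
  have "sphere 0 1 \<in> sets borel_sphere" by (simp add: sets_restrict_space_iff)
  then have "emeasure \<mu> (sphere 0 1) = ennreal (\<Sum>i | i \<in> {1..m} \<and> v i \<in> sphere 0 1. c i)"
    by (rule emeasure_discrete_on_sphere[OF assms])
  also have "{i. i \<in> {1..m} \<and> v i \<in> sphere 0 1} = {1..m}"
    using assms unfolding discrete_on_sphere_def by blast
  finally show ?thesis .
qed

lemma inner_pos_if_not_in_hemisphere:
  fixes v :: "'i \<Rightarrow> real ^ 'n"
  assumes unit: "v ` I \<subseteq> sphere 0 1" and no: "\<not> (\<exists>H. closed_hemisphere H \<and> v ` I \<subseteq> H)"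
    and u: "norm u = 1"
  shows "\<exists>i\<in>I. 0 < u \<bullet> v i"
proof (rule ccontr)
  assume "\<not> (\<exists>i\<in>I. 0 < u \<bullet> v i)"
  then have "v ` I \<subseteq> {w \<in> sphere 0 1. 0 \<le> - u \<bullet> w}"
    using unit by (auto simp: not_less)
  moreover have "closed_hemisphere {w \<in> sphere 0 1. 0 \<le> - u \<bullet> w}"
    unfolding closed_hemisphere_def using u by (intro bexI[of _ "- u"]) auto
  ultimately show False using no by blast
qed

text \<open>If the directions in \<open>I\<close> lie in a closed hemisphere, this is the weak Aleksandrov relation for
  the finite set \<open>v ` I\<close>, with \<open>d = sin \<alpha>\<close>, the cosine of \<open>pi / 2 - \<alpha>\<close>. Otherwise the set on the
  right is the whole sphere for small \<open>d\<close>, and the total masses agree.\<close>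

lemma weakly_Aleksandrov_margin:
  fixes v :: "nat \<Rightarrow> real ^ 'n"
  assumes \<mu>: "discrete_on_sphere \<mu> m c v" and weak: "weakly_Aleksandrov_related \<mu> M"
    and M: "finite_measure M" and I: "I \<subseteq> {1..m}"
  shows "\<exists>d>0. (\<Sum>i\<in>I. c i) \<le> measure M {u \<in> sphere 0 1. \<exists>i\<in>I. d < u \<bullet> v i}"
proof -
  interpret finite_measure M by (rule M)
  have fin: "finite I" using I finite_subset by blast
  have unit: "v ` {1..m} \<subseteq> sphere 0 1" and inj: "inj_on v {1..m}" and c: "\<And>i. i \<in> {1..m} \<Longrightarrow> 0 < c i"
    using \<mu> by (auto simp: discrete_on_sphere_def)
  show ?thesis
  proof (cases "\<exists>H. closed_hemisphere H \<and> v ` I \<subseteq> H")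
    case True
    have sub: "v ` I \<subseteq> sphere 0 1" using unit I by blast
    have cl: "closed (v ` I)" using fin by (intro finite_imp_closed finite_imageI)
    obtain \<alpha> where \<alpha>: "0 < \<alpha>" "\<alpha> < pi / 2"
      "emeasure \<mu> (v ` I) \<le> emeasure M (outer_parallel (v ` I) (pi / 2 - \<alpha>))"
      using weak True sub cl unfolding weakly_Aleksandrov_related_def by blast
    have "v ` I \<in> sets borel_sphere" using cl sub by (auto simp: sets_restrict_space_iff)
    then have "emeasure \<mu> (v ` I) = ennreal (\<Sum>i | i \<in> {1..m} \<and> v i \<in> v ` I. c i)"
      by (rule emeasure_discrete_on_sphere[OF \<mu>])
    also have "{i. i \<in> {1..m} \<and> v i \<in> v ` I} = I"
      using I inj_on_image_mem_iff[OF inj] by blast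
    finally have "ennreal (\<Sum>i\<in>I. c i) \<le> emeasure M (outer_parallel (v ` I) (pi / 2 - \<alpha>))"
      using \<alpha>(3) by simp
    moreover have "outer_parallel (v ` I) (pi / 2 - \<alpha>) = {u \<in> sphere 0 1. \<exists>i\<in>I. sin \<alpha> < u \<bullet> v i}"
      by (auto simp: outer_parallel_def cos_diff inner_commute)
    ultimately have "(\<Sum>i\<in>I. c i) \<le> measure M {u \<in> sphere 0 1. \<exists>i\<in>I. sin \<alpha> < u \<bullet> v i}"
      by (simp add: emeasure_eq_measure)
    moreover have "0 < sin \<alpha>" using \<alpha> by (intro sin_gt_zero) auto
    ultimately show ?thesis by blast
  next
    case False
    have "v ` I \<subseteq> sphere 0 1" using unit I by blast
    then have "\<exists>i\<in>I. 0 < u \<bullet> v i" if "norm u = 1" for u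
      using False that by (rule inner_pos_if_not_in_hemisphere)
    then obtain d where d: "0 < d" "\<And>u. norm u = 1 \<Longrightarrow> \<exists>i\<in>I. d < u \<bullet> v i"
      by (rule uniform_margin[OF fin]) auto
    have "ennreal (\<Sum>i\<in>{1..m}. c i) = emeasure M (sphere 0 1)"
      using weak emeasure_discrete_on_sphere_total[OF \<mu>] unfolding weakly_Aleksandrov_related_def by metis
    then have "ennreal (\<Sum>i\<in>{1..m}. c i) \<le> ennreal (measure M (sphere 0 1))"
      by (simp only: emeasure_eq_measure)
    then have "(\<Sum>i\<in>{1..m}. c i) \<le> measure M (sphere 0 1)"
      by (simp only: ennreal_le_iff[OF measure_nonneg])
    moreover have "(\<Sum>i\<in>I. c i) \<le> (\<Sum>i\<in>{1..m}. c i)"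
      using I c by (intro sum_mono2) (auto intro: less_imp_le)
    moreover have "{u \<in> sphere 0 1. \<exists>i\<in>I. d < u \<bullet> v i} = sphere 0 1" using d(2) by auto
    ultimately show ?thesis using d(1) by (intro exI[of _ d]) simp
  qed
qed

theorem theorem1p4:
  fixes \<mu> \<nu> :: "(real ^ 'n) measure"
    and m :: nat and c :: "nat \<Rightarrow> real" and v :: "nat \<Rightarrow> real ^ 'n"
  assumes "discrete_on_sphere \<mu> m c v"
    and "\<not> (\<exists>H. closed_hemisphere H \<and> v ` {1..m} \<subseteq> H)"
    and "sets \<nu> = sets borel_sphere"
    and "absolutely_continuous spherical_lebesgue \<nu>"
    and "weakly_Aleksandrov_related \<mu> \<nu>"
  shows "\<exists>P\<in>polytopes_with_directions m v.
           \<forall>\<omega>\<in>sets borel_sphere. emeasure \<mu> \<omega> = Gauss_image_measure \<nu> P \<omega>"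
proof -
  let ?J = "{1..m}"
  have inj: "inj_on v ?J" and unit: "\<And>j. j \<in> ?J \<Longrightarrow> norm (v j) = 1"
    and c: "\<And>i. i \<in> ?J \<Longrightarrow> 0 < c i"
    using assms(1) by (auto simp: discrete_on_sphere_def)
  have c_sum: "0 \<le> (\<Sum>i\<in>?J. c i)" using c by (intro sum_nonneg less_imp_le)
  have mass: "emeasure \<nu> (sphere 0 1) = ennreal (\<Sum>i\<in>?J. c i)"
    using assms(5) emeasure_discrete_on_sphere_total[OF assms(1)]
    unfolding weakly_Aleksandrov_related_def by metis
  have space: "space \<nu> = sphere 0 1"
    using sets_eq_imp_space_eq[OF assms(3)] by (simp add: space_restrict_space)
  interpret spread_directions_measure ?J v \<nu>
  proof (intro spread_directions_measure.intro spread_directions.intro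
      spread_directions_measure_axioms.intro)
    have "v ` ?J \<subseteq> sphere 0 1" using unit by auto
    then show "\<exists>j\<in>?J. 0 < u \<bullet> v j" if "norm u = 1" for u
      using assms(2) that by (rule inner_pos_if_not_in_hemisphere)
    show "finite_measure \<nu>" by (rule finite_measureI) (simp add: space mass)
  qed (use inj unit assms(3,4) in auto)
  have "\<forall>I\<in>Pow ?J. \<exists>d>0. (\<Sum>i\<in>I. c i) \<le> measure \<nu> {u \<in> sphere 0 1. \<exists>i\<in>I. d < u \<bullet> v i}"
    using weakly_Aleksandrov_margin[OF assms(1,5) finite_M] by blast
  from bchoice[OF this] obtain f where f_all: "\<forall>I\<in>Pow ?J. 0 < f I \<and>
      (\<Sum>i\<in>I. c i) \<le> measure \<nu> {u \<in> sphere 0 1. \<exists>i\<in>I. f I < u \<bullet> v i}"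
    by (rule exE)
  note f_pos = bspec[OF f_all, THEN conjunct1] and f_margin = bspec[OF f_all, THEN conjunct2]
  (* One margin for all subsets; the entry 1/2 only ensures d < 1. *)
  define d where "d = Min (insert (1/2) (f ` Pow ?J))"
  have "0 < d" unfolding d_def using f_pos by (subst Min_gr_iff) auto
  have d_le: "d \<le> x" if "x \<in> insert (1/2) (f ` Pow ?J)" for x
    unfolding d_def using that by (intro Min_le) auto
  have "d < 1" using d_le[of "1/2"] by simp
  have margin: "(\<Sum>i\<in>I. c i) \<le> measure \<nu> {u \<in> sphere 0 1. \<exists>i\<in>I. d < u \<bullet> v i}" if I: "I \<subseteq> ?J" for I
  proof -
    have "{u \<in> sphere 0 1. \<exists>i\<in>I. d < u \<bullet> v i} = sphere 0 1 \<inter> (\<Union>i\<in>I. {u. d < u \<bullet> v i})"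
      by auto
    also have "\<dots> \<in> sets borel"
      by (intro sets.Int borel_closed[OF closed_sphere] borel_open open_UN ballI
          open_Collect_less continuous_intros)
    finally have meas: "{u \<in> sphere 0 1. \<exists>i\<in>I. d < u \<bullet> v i} \<in> sets \<nu>"
      by (auto simp: assms(3) sets_restrict_space_iff)
    have "d \<le> f I" using I by (intro d_le) auto
    then have "measure \<nu> {u \<in> sphere 0 1. \<exists>i\<in>I. f I < u \<bullet> v i}
        \<le> measure \<nu> {u \<in> sphere 0 1. \<exists>i\<in>I. d < u \<bullet> v i}"
      using meas by (intro finite_measure_mono subsetI) (auto intro: le_less_trans)
    with f_margin[of I] I show ?thesis by auto
  qed
  have total: "(\<Sum>i\<in>?J. c i) = measure \<nu> (sphere 0 1)"
    using mass c_sum by (simp add: measure_def)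
  obtain b where b: "\<And>j. j \<in> ?J \<Longrightarrow> 0 < b j"
    and cells: "\<And>j. j \<in> ?J \<Longrightarrow> measure \<nu> (vertex_cell b j) = c j"
  proof (rule prescribed_cell_measures[OF total \<open>0 < d\<close> \<open>d < 1\<close> margin])
    fix b
    assume "\<And>j. j \<in> ?J \<Longrightarrow> 0 < b j" "\<And>j. j \<in> ?J \<Longrightarrow> measure \<nu> (vertex_cell b j) = c j"
    then show thesis by (rule that)
  qed
  have "emeasure \<mu> \<omega> = Gauss_image_measure \<nu> (hull_of_scaled b) \<omega>" if \<omega>: "\<omega> \<in> sets borel_sphere" for \<omega>
  proof -
    have sub: "\<omega> \<subseteq> sphere 0 1"
      using sets.sets_into_space[OF \<omega>] by (simp add: space_restrict_space)
    have "Gauss_image_measure \<nu> (hull_of_scaled b) \<omega> =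
        ennreal (\<Sum>i | i \<in> ?J \<and> v i \<in> \<omega>. measure \<nu> (vertex_cell b i))"
      using b sub by (rule Gauss_image_measure_hull_of_scaled)
    also have "\<dots> = ennreal (\<Sum>i | i \<in> ?J \<and> v i \<in> \<omega>. c i)"
      using cells by (intro arg_cong[of _ _ ennreal] sum.cong) auto
    also have "\<dots> = emeasure \<mu> \<omega>"
      by (rule emeasure_discrete_on_sphere[OF assms(1) \<omega>, symmetric])
    finally show ?thesis by simp
  qed
  moreover have "hull_of_scaled b \<in> polytopes_with_directions m v"
    unfolding polytopes_with_directions_def hull_of_scaled_def using b by blast
  ultimately show ?thesis by blast
qed

end
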